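(* Let $H$ be a Hilbert space and let $\mathcal K\subset H$ be a compact subset with $\sup_{f\in\mathcal K}\|f\|_H=1$. Then the following hold. (1) Let $\alpha>0$, $\beta\in\mathbb R$, $C>0$. If $e_n(\mathcal K)_H\ge C\,\dfrac{[\log_2 n]^\beta}{n^\alpha}$ for all $n=2,3,\ldots$, then there is a constant $C''>0$ such that for every $N>1$ $$d_{n-1}(\mathcal K,N)_H\ge C''\,\frac{[\log_2(n+\lceil\log_2N\rceil)]^{\beta-\alpha}}{[n+\lceil\log_2N\rceil]^\alpha},\qquad n=1,2,\ldots.$$ (2) Let $\alpha>0$, $C>0$. If $e_n(\mathcal K)_H\ge \dfrac{C}{[\log_2 n]^\alpha}$ for all $n=2,3,\ldots$, then there is a constant $C''>0$ such that for every $N>1$ $$d_{n-1}(\mathcal K,N)_H\ge C''\,\frac{1}{[\log_2(n+\lceil\log_2N\rceil)]^{\alpha}},\qquad n=1,2,\ldots.$$ (3) Let $0<\alpha<1$ and $C,c>0$. If $e_n(\mathcal K)_H\ge C\,2^{-cn^\alpha}$ for all $n=1,2,\ldots$, then there are constants $C'',c''>0$ such that for every $N>1$ $$d_{n-1}(\mathcal K,N)_H\ge C''\,2^{-c''(n+\lceil\log_2N\rceil)^{\alpha/(1-\alpha)}},\qquad n=1,2,\ldots.$$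
   Context: All linear spaces are over the real numbers. For a compact set $\mathcal K$ in a normed space $X$ the entropy numbers are $$e_n(\mathcal K)_X=\inf\Big\{\epsilon>0:\ \mathcal K\subset\bigcup_{j=1}^{2^n}B(g_j,\epsilon)\ \text{for some } g_1,\ldots,g_{2^n}\in X\Big\},\quad n\ge 0,$$ where $B(g,\epsilon)=\{f\in X:\|f-g\|_X\le\epsilon\}$. For real $N\ge1$ the nonlinear Kolmogorov $(n,N)$-width is $$d_0(\mathcal K,N)_X=\sup_{f\in\mathcal K}\|f\|_X,\qquad d_n(\mathcal K,N)_X=\inf_{\mathcal L_N}\ \sup_{f\in\mathcal K}\ \inf_{X_n\in\mathcal L_N}\operatorname{dist}(f,X_n)_X,\quad n\ge1,$$ where the outer infimum is over all sets $\mathcal L_N$ of at most $N$ linear subspaces $X_n\subset X$ of dimension $n$. The constants $C'',c''$ may depend on $\mathcal K$ and on $\alpha,\beta,C,c$, but not on $n$ or $N$. *)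

theory Defs
  imports "HOL-Analysis.Analysis"
begin

text \<open>
  Infima and suprema are taken in \<^typ>\<open>ereal\<close>, so that no nonemptiness or boundedness
  side conditions are hidden in them.
\<close>

definition entropy_number :: "nat \<Rightarrow> 'a::real_normed_vector set \<Rightarrow> ereal" where
  "entropy_number n K =
    (INF \<epsilon>\<in>{\<epsilon>::real. \<epsilon> > 0 \<and> (\<exists>g :: nat \<Rightarrow> 'a. K \<subseteq> (\<Union>j\<in>{1..2 ^ n}. cball (g j) \<epsilon>))}. ereal \<epsilon>)"

text \<open>
  The library's \<^term>\<open>dim V\<close> is \<open>0\<close> when \<open>V\<close> is infinite-dimensional; as \<open>n > 0\<close> in the branch
  where it is used, \<^prop>\<open>dim V = n\<close> there does mean that \<open>V\<close> has finite dimension \<open>n\<close>.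
  The empty family of subspaces is admitted, but contributes \<open>\<infinity>\<close> for nonempty \<open>K\<close>.
\<close>

definition nonlinear_kolmogorov_width :: "nat \<Rightarrow> 'a::real_normed_vector set \<Rightarrow> real \<Rightarrow> ereal" where
  "nonlinear_kolmogorov_width n K N =
    (if n = 0 then (SUP f\<in>K. ereal (norm f))
     else (INF L\<in>{L. finite L \<and> real (card L) \<le> N \<and> (\<forall>V\<in>L. subspace V \<and> dim V = n)}.
             SUP f\<in>K. INF V\<in>L. ereal (infdist f V)))"

end

theory Submission
  imports Defs "HOL-Real_Asymp.Real_Asymp"
begin

text \<open>
  A set that is well approximated by few low-dimensional subspaces has small entropy.  Suppose that
  every \<open>f \<in> K\<close> lies within \<open>\<epsilon> \<le> 1\<close> of one of at most \<open>N\<close> subspaces of dimension \<open>m = n - 1\<close>.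
  As \<open>\<parallel>f\<parallel> \<le> 1\<close>, its approximant has norm at most \<open>2\<close>, and the ball of radius \<open>2\<close> in an
  \<open>m\<close>-dimensional inner product space has a net of radius \<open>m / 2\<^sup>s\<close> with \<open>2\<close> to the power
  \<open>m (s + 3)\<close> points, obtained by rounding orthonormal coordinates (\<open>finite_dimensional_net\<close>).  The
  union of these nets covers \<open>K\<close>.  So, with \<open>x = n + \<lceil>log 2 N\<rceil>\<close>,
  the entropy number of index \<open>x (s + 3)\<close> is at most \<open>\<epsilon> + m / 2\<^sup>s \<le> 2 \<epsilon>\<close> as soon as
  \<open>x / 2\<^sup>s \<le> \<epsilon>\<close>.
  Contrapositively, an entropy number of index \<open>x (s + 3)\<close> above \<open>2 \<epsilon>\<close> forces the width to be at
  least \<open>\<epsilon>\<close> (\<open>width_lower_bound\<close>).  The two parameters \<open>n\<close> and \<open>N\<close> enter through \<open>x\<close> alone, and it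
  remains to choose \<open>\<epsilon>\<close> and \<open>s\<close> as functions of \<open>x\<close>.

  A comparison of volumes would give a net of radius \<open>\<epsilon>\<close> with at most \<open>(5 / \<epsilon>)\<^sup>m\<close> points, where the
  rounding of coordinates needs about \<open>(8 m / \<epsilon>)\<^sup>m\<close>.  The additional factor \<open>m\<close> costs a summand of
  order \<open>log x\<close> in \<open>s\<close>.  The three estimates tolerate it: in the first two cases any \<open>s\<close> of order
  \<open>log x\<close> is good enough, and in the third one \<open>s\<close> is of the order of a positive power of \<open>x\<close>.

  \<^item> If \<open>e\<^sub>k \<ge> C (log k)\<^sup>\<beta> / k\<^sup>\<alpha>\<close>, take \<open>\<epsilon> = \<eta> (log x) powr (\<beta> - \<alpha>) / x\<^sup>\<alpha>\<close> with \<open>\<eta> = 1 / 2\<^sup>u\<close>.  Then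
    \<open>s \<le> A log x\<close> with \<open>A\<close> linear in \<open>u\<close>, the index \<open>k = x (s + 3)\<close> is of order \<open>x log x\<close>, and \<open>e\<^sub>k\<close>
    exceeds a multiple of \<open>(log x) powr (\<beta> - \<alpha>) / x\<^sup>\<alpha>\<close>, where the factor is a constant times a
    negative power of \<open>A\<close>.  Since \<open>\<eta>\<close> decays exponentially in \<open>u\<close>, it lies below that factor for large \<open>u\<close>
    (\<open>log_power_levels\<close>).
  \<^item> The purely logarithmic bound is the same statement with \<open>\<alpha> = 0\<close> and a negative exponent of the
    logarithm, so one argument serves for both.
  \<^item> If \<open>e\<^sub>k \<ge> C 2 powr (- c k\<^sup>\<alpha>)\<close>, take \<open>\<epsilon> = x / 2\<^sup>s\<close>.  The condition on \<open>t = s + 3\<close> becomes, up to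
    lower order terms, \<open>c (x t)\<^sup>\<alpha> < t\<close>, which holds for \<open>t\<close> a large multiple of
    \<open>x powr (\<alpha> / (1 - \<alpha>))\<close> (\<open>width_ge_subexponential\<close>).
\<close>

section \<open>Nets in finite-dimensional subspaces\<close>

text \<open>
  Normalising with \<^const>\<open>sgn\<close> lets \<open>C\<close> contain \<open>0\<close>, as the output of orthogonalisation may; the
  zero vector then contributes a zero term.
\<close>

lemma orthogonal_expansion:
  fixes C :: "'a::real_inner set"
  assumes "finite C" "pairwise orthogonal C" "v \<in> span C"
  shows "v = (\<Sum>c\<in>C. (v \<bullet> sgn c) *\<^sub>R sgn c)"
proof -
  obtain u where u: "v = (\<Sum>c\<in>C. u c *\<^sub>R c)"
    using assms(1,3) by (auto simp: span_finite)
  have "(v \<bullet> sgn d) *\<^sub>R sgn d = u d *\<^sub>R d" if "d \<in> C" for d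
  proof -
    have "v \<bullet> d = (\<Sum>c\<in>C. u c * (c \<bullet> d))"
      by (simp add: u inner_sum_left)
    also have "\<dots> = (\<Sum>c\<in>C. if c = d then u c * (c \<bullet> d) else 0)"
      using assms(2) that
      by (intro sum.cong refl) (auto simp: pairwise_def orthogonal_def)
    also have "\<dots> = u d * (norm d)\<^sup>2"
      using assms(1) that by (simp add: power2_norm_eq_inner)
    finally have "v \<bullet> d = u d * (norm d)\<^sup>2" .
    then show ?thesis
      by (cases "d = 0") (simp_all add: sgn_div_norm power2_eq_square)
  qed
  then show ?thesis
    by (subst u) simp
qed

text \<open>
  Each coordinate of \<open>v\<close> with respect to an orthonormal basis lies in \<open>[-2, 2]\<close>.  Rounding all of
  them down to multiples of \<open>1 / 2\<^sup>s\<close> moves \<open>v\<close> by at most \<open>1 / 2\<^sup>s\<close> in each of at most \<open>m\<close>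
  directions, and each coordinate then takes at most \<open>4 \<cdot> 2\<^sup>s + 1 \<le> 8 \<cdot> 2\<^sup>s\<close> values.
\<close>

lemma finite_dimensional_net:
  fixes V :: "'a::real_inner set"
  assumes "subspace V" "dim V = m" "m > 0"
  obtains F where "finite F" "card F \<le> 2 ^ (m * (s + 3))"
    "\<And>v. v \<in> V \<Longrightarrow> norm v \<le> 2 \<Longrightarrow> \<exists>c\<in>F. dist v c \<le> real m / 2 ^ s"
proof -
  obtain B where B: "B \<subseteq> V" "independent B" "V \<subseteq> span B" "card B = m"
    using basis_exists[of V] assms(2) by metis
  \<comment> \<open>Positive dimension excludes infinite bases, whose cardinality is \<open>0\<close> by convention.\<close>
  have "finite B" using B(4) assms(3) card_ge_0_finite by blast
  moreover have "span B = V"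
    using B(1,3) assms(1) span_minimal by blast
  ultimately obtain C where C: "finite C" "card C \<le> m" "span C = V" "pairwise orthogonal C"
    using basis_orthogonal[of B] B(4) by auto
  define J where "J = {- (2 * 2 ^ s) .. (2 * 2 ^ s :: int)}"
  define P where "P = (\<lambda>j :: 'a \<Rightarrow> int. \<Sum>c\<in>C. (of_int (j c) / 2 ^ s) *\<^sub>R sgn c)"
  define F where "F = P ` (PiE C (\<lambda>_. J))"
  have fin: "finite (PiE C (\<lambda>_. J))"
    using C(1) by (intro finite_PiE) (auto simp: J_def)
  have cardJ: "card J \<le> 2 ^ (s + 3)"
  proof -
    have "(4 * 2 ^ s + 1 :: nat) \<le> 8 * 2 ^ s"
      using one_le_power[of "2::nat" s] by linarith
    moreover have "card J = 4 * 2 ^ s + 1"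
      by (simp add: J_def nat_add_distrib nat_mult_distrib nat_power_eq)
    ultimately show ?thesis by (simp add: power_add)
  qed
  have "card F \<le> card (PiE C (\<lambda>_. J))"
    unfolding F_def by (rule card_image_le[OF fin])
  also have "\<dots> = card J ^ card C"
    using C(1) by (simp add: card_PiE)
  also have "\<dots> \<le> (2 ^ (s + 3)) ^ card C"
    using cardJ by (rule power_mono) simp
  also have "\<dots> \<le> (2 ^ (s + 3)) ^ m"
    using C(2) by (intro power_increasing) auto
  also have "\<dots> = 2 ^ (m * (s + 3))"
    by (simp add: power_mult [symmetric] mult.commute)
  finally have cardF: "card F \<le> 2 ^ (m * (s + 3))" .
  have net: "\<exists>c\<in>F. dist v c \<le> real m / 2 ^ s" if v: "v \<in> V" "norm v \<le> 2" for v
  proof -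
    define j where "j = restrict (\<lambda>c. \<lfloor>(v \<bullet> sgn c) * 2 ^ s\<rfloor>) C"
    have sgn1: "norm (sgn c) \<le> 1" for c :: 'a
      by (simp add: norm_sgn)
    have coeff: "\<bar>v \<bullet> sgn c\<bar> \<le> 2" for c
    proof -
      have "\<bar>v \<bullet> sgn c\<bar> \<le> norm v * norm (sgn c)" by (rule Cauchy_Schwarz_ineq2)
      also have "\<dots> \<le> 2 * 1" using v(2) sgn1 by (intro mult_mono) auto
      finally show ?thesis by simp
    qed
    have "j c \<in> J" if "c \<in> C" for c
    proof -
      have "\<bar>v \<bullet> sgn c\<bar> * 2 ^ s \<le> 2 * 2 ^ s"
        using coeff by (intro mult_right_mono) auto
      then have "\<bar>(v \<bullet> sgn c) * 2 ^ s\<bar> \<le> 2 * 2 ^ s"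
        by (simp add: abs_mult)
      then have "- (2 * 2 ^ s) \<le> (v \<bullet> sgn c) * 2 ^ s" "(v \<bullet> sgn c) * 2 ^ s \<le> 2 * 2 ^ s"
        by linarith+
      moreover have "\<lfloor>r\<rfloor> \<in> J" if "- (2 * 2 ^ s) \<le> r" "r \<le> 2 * 2 ^ s" for r :: real
        using that unfolding J_def by (simp add: le_floor_iff floor_le_iff)
      ultimately have "\<lfloor>(v \<bullet> sgn c) * 2 ^ s\<rfloor> \<in> J" by blast
      then show ?thesis using that by (simp add: j_def)
    qed
    then have jP: "j \<in> PiE C (\<lambda>_. J)"
      by (auto simp: j_def)
    have err: "norm ((v \<bullet> sgn c - of_int (j c) / 2 ^ s) *\<^sub>R sgn c) \<le> 1 / 2 ^ s" if "c \<in> C" for c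
    proof -
      have "\<bar>(v \<bullet> sgn c) * 2 ^ s - of_int (j c)\<bar> \<le> 1"
        using that by (simp add: j_def) linarith
      moreover have "\<bar>v \<bullet> sgn c - of_int (j c) / 2 ^ s\<bar> = \<bar>(v \<bullet> sgn c) * 2 ^ s - of_int (j c)\<bar> / 2 ^ s"
        by (simp add: field_simps abs_if)
      ultimately have "\<bar>v \<bullet> sgn c - of_int (j c) / 2 ^ s\<bar> \<le> 1 / 2 ^ s"
        by (simp add: divide_right_mono)
      then have "\<bar>v \<bullet> sgn c - of_int (j c) / 2 ^ s\<bar> * norm (sgn c) \<le> 1 / 2 ^ s * 1"
        using sgn1 by (intro mult_mono) auto
      then show ?thesis by simp
    qed
    have "v - P j = (\<Sum>c\<in>C. (v \<bullet> sgn c) *\<^sub>R sgn c) - P j"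
      using orthogonal_expansion[OF C(1,4)] C(3) v(1) by simp
    also have "\<dots> = (\<Sum>c\<in>C. (v \<bullet> sgn c - of_int (j c) / 2 ^ s) *\<^sub>R sgn c)"
      by (simp add: P_def sum_subtractf scaleR_left_diff_distrib)
    finally have "dist v (P j) \<le> (\<Sum>c\<in>C. norm ((v \<bullet> sgn c - of_int (j c) / 2 ^ s) *\<^sub>R sgn c))"
      by (simp only: dist_norm norm_sum)
    also have "\<dots> \<le> (\<Sum>c\<in>C. 1 / 2 ^ s)"
      using err by (rule sum_mono)
    also have "\<dots> = real (card C) / 2 ^ s" by simp
    also have "\<dots> \<le> real m / 2 ^ s"
      using C(2) by (simp add: divide_right_mono)
    finally show ?thesis using jP F_def by blast
  qed
  show thesis
    using that[of F] fin cardF net by (simp add: F_def)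
qed

section \<open>From widths to entropy numbers\<close>

lemma entropy_number_le_cover:
  fixes K :: "'a::real_normed_vector set"
  assumes "finite F" "card F \<le> 2 ^ k" "r > 0" "K \<subseteq> (\<Union>c\<in>F. cball c r)"
  shows "entropy_number k K \<le> ereal r"
proof -
  obtain h where h: "bij_betw h {1..card F} F"
    using ex_bij_betw_nat_finite_1[OF assms(1)] by blast
  have "F \<subseteq> h ` {1..2 ^ k}"
    using h assms(2) by (force simp: bij_betw_def)
  then have "K \<subseteq> (\<Union>j\<in>{1..2 ^ k}. cball (h j) r)"
    using assms(4) by fastforce
  then have "r \<in> {\<epsilon>::real. \<epsilon> > 0 \<and> (\<exists>g :: nat \<Rightarrow> 'a. K \<subseteq> (\<Union>j\<in>{1..2 ^ k}. cball (g j) \<epsilon>))}"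
    using assms(3) by blast
  then show ?thesis
    unfolding entropy_number_def by (rule INF_lower)
qed

lemma entropy_number_le_one:
  fixes K :: "'a::real_normed_vector set"
  assumes "(SUP f\<in>K. ereal (norm f)) = 1"
  shows "entropy_number k K \<le> 1"
proof -
  have "norm f \<le> 1" if "f \<in> K" for f
    using SUP_upper[OF that, of "\<lambda>f. ereal (norm f)"] assms by simp
  then have "entropy_number k K \<le> ereal 1"
    by (intro entropy_number_le_cover[of "{0}"]) auto
  then show ?thesis by (simp add: one_ereal_def)
qed

text \<open>
  The union over the subspaces of the nets of their balls of radius \<open>2\<close> covers \<open>K\<close>: go from \<open>f\<close> to an
  almost nearest point of the best subspace, and from there to the net.
\<close>

lemma entropy_number_le_of_width:
  fixes K :: "'a::real_inner set"
  assumes norm1: "\<And>f. f \<in> K \<Longrightarrow> norm f \<le> 1"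
    and m: "m > 0" and N: "N \<le> 2 ^ p"
    and \<epsilon>: "0 < \<epsilon>" "\<epsilon> \<le> 1"
    and width: "nonlinear_kolmogorov_width m K N < ereal \<epsilon>"
    and k: "p + m * (s + 3) \<le> k"
  shows "entropy_number k K \<le> ereal (\<epsilon> + real m / 2 ^ s)"
proof -
  obtain L where L: "finite L" "real (card L) \<le> N" "\<forall>V\<in>L. subspace V \<and> dim V = m"
    and less: "(SUP f\<in>K. INF V\<in>L. ereal (infdist f V)) < ereal \<epsilon>"
    using width m by (auto simp: nonlinear_kolmogorov_width_def INF_less_iff)
  have "\<forall>V. \<exists>F. V \<in> L \<longrightarrow> finite F \<and> card F \<le> 2 ^ (m * (s + 3)) \<and>
      (\<forall>v\<in>V. norm v \<le> 2 \<longrightarrow> (\<exists>c\<in>F. dist v c \<le> real m / 2 ^ s))"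
    using L(3) m by (metis finite_dimensional_net)
  then obtain net where net: "\<And>V. V \<in> L \<Longrightarrow> finite (net V)"
      "\<And>V. V \<in> L \<Longrightarrow> card (net V) \<le> 2 ^ (m * (s + 3))"
      "\<And>V v. V \<in> L \<Longrightarrow> v \<in> V \<Longrightarrow> norm v \<le> 2 \<Longrightarrow> \<exists>c\<in>net V. dist v c \<le> real m / 2 ^ s"
    by metis
  define F where "F = (\<Union>V\<in>L. net V)"
  have "real (card L) \<le> 2 ^ p" using L(2) N by linarith
  then have cardL: "card L \<le> 2 ^ p"
    by (metis of_nat_le_iff of_nat_numeral of_nat_power)
  have "card F \<le> (\<Sum>V\<in>L. card (net V))"
    unfolding F_def by (rule card_UN_le[OF L(1)])
  also have "\<dots> \<le> (\<Sum>V\<in>L. 2 ^ (m * (s + 3)))"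
    using net(2) by (rule sum_mono)
  also have "\<dots> \<le> 2 ^ p * 2 ^ (m * (s + 3))"
    using cardL by simp
  also have "\<dots> \<le> 2 ^ k"
    unfolding power_add[symmetric] using k by (intro power_increasing) auto
  finally have "card F \<le> 2 ^ k" .
  moreover have "finite F" using L(1) net(1) by (simp add: F_def)
  moreover have "0 < \<epsilon> + real m / 2 ^ s" using \<epsilon>(1) by (simp add: add_pos_nonneg)
  moreover have "K \<subseteq> (\<Union>c\<in>F. cball c (\<epsilon> + real m / 2 ^ s))"
  proof
    fix f assume f: "f \<in> K"
    have "(INF V\<in>L. ereal (infdist f V)) < ereal \<epsilon>"
      using less SUP_upper[OF f, of "\<lambda>f. INF V\<in>L. ereal (infdist f V)"] by simp
    then obtain V where V: "V \<in> L" "infdist f V < \<epsilon>"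
      by (auto simp: INF_less_iff)
    have "V \<noteq> {}" using L(3) V(1) subspace_0 by blast
    then obtain v where v: "v \<in> V" "dist f v < \<epsilon>"
      using V(2) by (auto simp: infdist_notempty cInf_less_iff)
    have "norm v \<le> norm f + dist f v"
      using norm_triangle_sub[of v f] by (simp add: dist_norm norm_minus_commute)
    then have "norm v \<le> 2" using norm1[OF f] v(2) \<epsilon>(2) by linarith
    then obtain c where c: "c \<in> net V" "dist v c \<le> real m / 2 ^ s"
      using net(3) V(1) v(1) by blast
    have "dist f c \<le> \<epsilon> + real m / 2 ^ s"
      using dist_triangle[of f c v] v(2) c(2) by linarith
    then show "f \<in> (\<Union>c\<in>F. cball c (\<epsilon> + real m / 2 ^ s))"
      using c(1) V(1) by (auto simp: F_def dist_commute)
  qed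
  ultimately show ?thesis by (intro entropy_number_le_cover)
qed

text \<open>
  For \<open>n \<ge> 2\<close> this is the contrapositive of the covering estimate.  The width of index \<open>0\<close> is the
  radius \<open>1\<close> of \<open>K\<close>, and \<open>2 \<epsilon> < 1\<close> because no entropy number of \<open>K\<close> exceeds its radius.
\<close>

lemma width_lower_bound:
  fixes K :: "'a::real_inner set"
  assumes sup1: "(SUP f\<in>K. ereal (norm f)) = 1"
    and n: "n \<ge> 1" and N: "N \<le> 2 ^ p"
    and \<epsilon>: "0 < \<epsilon>" "real (n + p) / 2 ^ s \<le> \<epsilon>"
    and entropy: "ereal (2 * \<epsilon>) < entropy_number ((n + p) * (s + 3)) K"
  shows "ereal \<epsilon> \<le> nonlinear_kolmogorov_width (n - 1) K N"
proof (rule ccontr)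
  assume "\<not> ?thesis"
  then have width: "nonlinear_kolmogorov_width (n - 1) K N < ereal \<epsilon>" by simp
  have "ereal (2 * \<epsilon>) < 1"
    using entropy entropy_number_le_one[OF sup1] less_le_trans by blast
  then have "\<epsilon> \<le> 1" using \<epsilon>(1) by (simp add: one_ereal_def)
  show False
  proof (cases "n = 1")
    case True
    then have "nonlinear_kolmogorov_width (n - 1) K N = 1"
      using sup1 by (simp add: nonlinear_kolmogorov_width_def)
    then show False using width \<open>\<epsilon> \<le> 1\<close> by (simp add: one_ereal_def)
  next
    case False
    have "entropy_number ((n + p) * (s + 3)) K \<le> ereal (\<epsilon> + real (n - 1) / 2 ^ s)"
    proof (rule entropy_number_le_of_width[OF _ _ N \<epsilon>(1) \<open>\<epsilon> \<le> 1\<close> width])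
      show "norm f \<le> 1" if "f \<in> K" for f
        using SUP_upper[OF that, of "\<lambda>f. ereal (norm f)"] sup1 by simp
      show "0 < n - 1" using n False by simp
      have "p * 1 \<le> p * (s + 3)" by (intro mult_le_mono) auto
      moreover have "(n - 1) * (s + 3) \<le> n * (s + 3)" by (intro mult_le_mono) auto
      ultimately show "p + (n - 1) * (s + 3) \<le> (n + p) * (s + 3)"
        unfolding add_mult_distrib by linarith
    qed
    also have "\<dots> \<le> ereal (2 * \<epsilon>)"
    proof -
      have "real (n - 1) / 2 ^ s \<le> real (n + p) / 2 ^ s"
        by (intro divide_right_mono) auto
      then show ?thesis using \<epsilon>(2) by simp
    qed
    finally show False using entropy by simp
  qed
qed

text \<open>
  The form in which the estimate is used: \<open>n\<close> and \<open>N\<close> are replaced by the single integer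
  \<open>x = n + \<lceil>log 2 N\<rceil>\<close>, which is at least \<open>2\<close> because \<open>N > 1\<close>.
\<close>

lemma width_lower_bound_uniform:
  fixes K :: "'a::real_inner set" and \<phi> :: "real \<Rightarrow> real"
  assumes sup1: "(SUP f\<in>K. ereal (norm f)) = 1"
    and levels: "\<And>x::nat. x \<ge> 2 \<Longrightarrow> \<exists>s. \<exists>\<epsilon>>0. \<phi> (real x) \<le> \<epsilon> \<and> real x / 2 ^ s \<le> \<epsilon> \<and>
            ereal (2 * \<epsilon>) < entropy_number (x * (s + 3)) K"
    and N: "N > 1" and n: "n \<ge> (1::nat)"
  shows "ereal (\<phi> (real n + real_of_int \<lceil>log 2 N\<rceil>)) \<le> nonlinear_kolmogorov_width (n - 1) K N"
proof -
  define p where "p = nat \<lceil>log 2 N\<rceil>"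
  have "0 < log 2 N" using N by simp
  then have p: "p \<ge> 1" "real p = real_of_int \<lceil>log 2 N\<rceil>"
    unfolding p_def by linarith+
  have "N = 2 powr (log 2 N)" using N by simp
  also have "\<dots> \<le> 2 powr real p" unfolding p(2) by (intro powr_mono) auto
  finally have Np: "N \<le> 2 ^ p" by (simp add: powr_realpow)
  obtain s \<epsilon> where "\<epsilon> > 0" "\<phi> (real (n + p)) \<le> \<epsilon>" "real (n + p) / 2 ^ s \<le> \<epsilon>"
    "ereal (2 * \<epsilon>) < entropy_number ((n + p) * (s + 3)) K"
    using levels[of "n + p"] n p(1) by auto
  then have "ereal (\<phi> (real (n + p))) \<le> nonlinear_kolmogorov_width (n - 1) K N"
    using width_lower_bound[OF sup1 n Np] by (meson ereal_less_eq(3) order_trans)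
  then show ?thesis using p(2) by simp
qed

section \<open>Entropy numbers with a logarithmic factor\<close>

lemma log2_le_self:
  fixes y :: real
  assumes "y > 0"
  shows "log 2 y \<le> y"
proof -
  \<comment> \<open>The difference \<open>y ln 2 - ln y\<close> is minimal at \<open>y = 1 / ln 2\<close>, where it equals \<open>1 + ln (ln 2)\<close>.\<close>
  have "exp (-1) \<le> (1 / 2 :: real)"
    using exp_ge_add_one_self[of "1::real"] by (simp add: exp_minus field_simps)
  also have "\<dots> \<le> ln 2" using ln2_ge_two_thirds by linarith
  finally have "-1 \<le> ln (ln 2 :: real)"
    by (simp add: ln_ge_iff)
  moreover have "ln (y * ln 2) \<le> y * ln 2 - 1"
    using assms by (intro ln_le_minus_one) simp
  ultimately have "ln y \<le> y * ln 2"
    using assms by (simp add: ln_mult)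
  then show ?thesis by (simp add: log_def field_simps)
qed

lemma powr_less_exponential:
  fixes C D g :: real
  assumes "C > 0"
  obtains u :: nat where "2 * (3 * (real u + D)) powr g < C * 2 ^ u"
proof -
  have "((\<lambda>u::real. (3 * (u + D)) powr g / 2 powr u) \<longlongrightarrow> 0) at_top"
    by real_asymp
  then have "\<forall>\<^sub>F u in at_top. (3 * (u + D)) powr g / 2 powr u < C / 2"
    using assms by (intro order_tendstoD(2)) auto
  then have "\<forall>\<^sub>F n in sequentially. (3 * (real n + D)) powr g / 2 powr real n < C / 2"
    using filterlim_real_sequentially by (rule eventually_compose_filterlim)
  then obtain u :: nat where "(3 * (real u + D)) powr g / 2 powr real u < C / 2"
    by (meson eventually_sequentially order_refl)
  then show thesis
    by (intro that[of u]) (simp add: powr_realpow field_simps)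
qed

text \<open>
  The constant \<open>\<eta> = 1 / 2\<^sup>u\<close> enters twice: it scales the level \<open>\<epsilon> = \<eta> E\<close>, and through \<open>x / 2\<^sup>s \<le> \<epsilon>\<close>
  it enlarges \<open>s\<close>, hence the index \<open>k = x (s + 3)\<close> of the entropy number.  The second effect is only
  polynomial in \<open>u\<close>: with \<open>l = log 2 x\<close> and \<open>A = u + D\<close> one has \<open>x \<le> k \<le> A x l\<close> and
  \<open>l \<le> log 2 k \<le> 3 A l\<close>, so that the assumed lower bound at \<open>k\<close> is at least
  \<open>C (3 A) powr (- \<alpha> - \<bar>\<beta>\<bar>) E\<close>.  A large \<open>u\<close> therefore puts \<open>2 \<eta> E\<close> below it.
\<close>

lemma log_power_levels:
  fixes K :: "'a::real_normed_vector set" and \<alpha> \<beta> C :: real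
  assumes \<alpha>: "\<alpha> \<ge> 0" and C: "C > 0"
    and entropy: "\<And>n::nat. n \<ge> 2 \<Longrightarrow>
        ereal (C * (log 2 (real n) powr \<beta> / real n powr \<alpha>)) \<le> entropy_number n K"
  obtains \<eta> where "\<eta> > 0"
    "\<And>x::nat. x \<ge> 2 \<Longrightarrow>
      \<exists>s. real x / 2 ^ s \<le> \<eta> * (log 2 (real x) powr (\<beta> - \<alpha>) / real x powr \<alpha>) \<and>
        ereal (2 * (\<eta> * (log 2 (real x) powr (\<beta> - \<alpha>) / real x powr \<alpha>)))
          < entropy_number (x * (s + 3)) K"
proof -
  define b where "b = \<bar>\<beta> - \<alpha>\<bar>"
  \<comment> \<open>The slopes \<open>1\<close>, \<open>\<alpha>\<close> and \<open>b\<close> bound the logarithms of the three factors of \<open>x / E\<close> in units of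
    \<open>log 2 x\<close>; the remaining \<open>4\<close> pays for the \<open>3\<close> in \<open>s + 3\<close> and for rounding \<open>s\<close> up.\<close>
  define D where "D = 5 + \<alpha> + b"
  define g where "g = \<alpha> + \<bar>\<beta>\<bar>"
  obtain u :: nat where u: "2 * (3 * (real u + D)) powr g < C * 2 ^ u"
    using powr_less_exponential[OF C] by blast
  define A where "A = real u + D"
  have b: "b \<ge> 0" by (simp add: b_def)
  have A: "A \<ge> 1" using \<alpha> b by (simp add: A_def D_def)
  define \<eta> :: real where "\<eta> = 1 / 2 ^ u"
  have "\<eta> > 0" by (simp add: \<eta>_def)
  have \<eta>: "2 * \<eta> < C * (3 * A) powr (- g)"
  proof -
    have "2 * (3 * A) powr g < C * 2 ^ u" using u by (simp only: A_def)
    then show ?thesis using A by (simp add: \<eta>_def powr_minus field_simps)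
  qed
  have "\<exists>s. real x / 2 ^ s \<le> \<eta> * (log 2 (real x) powr (\<beta> - \<alpha>) / real x powr \<alpha>) \<and>
       ereal (2 * (\<eta> * (log 2 (real x) powr (\<beta> - \<alpha>) / real x powr \<alpha>))) < entropy_number (x * (s + 3)) K"
    if x: "x \<ge> 2" for x :: nat
  proof -
    define l where "l = log 2 (real x)"
    have l: "l \<ge> 1" using x by (simp add: l_def le_log_iff)
    have xl: "2 powr l = real x" using x by (simp add: l_def)
    have lx: "l \<le> real x" using x by (simp add: l_def log2_le_self)
    define E where "E = l powr (\<beta> - \<alpha>) / real x powr \<alpha>"
    have E: "E > 0" using l x by (simp add: E_def)
    define s where "s = nat \<lceil>(1 + \<alpha> + b + real u) * l\<rceil>"
    have pos: "0 \<le> (1 + \<alpha> + b + real u) * l" using \<alpha> b l by simp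
    have s_ge: "(1 + \<alpha> + b + real u) * l \<le> real s"
      unfolding s_def by linarith
    have "real s \<le> (1 + \<alpha> + b + real u) * l + 1"
      using pos unfolding s_def by linarith
    then have s_le: "real s + 3 \<le> A * l"
      using l by (simp add: A_def D_def algebra_simps)
    have level: "real x / 2 ^ s \<le> \<eta> * E"
    proof -
      have "l powr (\<alpha> - \<beta>) \<le> l powr b"
        using l by (intro powr_mono) (auto simp: b_def)
      also have "\<dots> \<le> real x powr b"
        using l lx b by (intro powr_mono2) auto
      finally have 1: "l powr (\<alpha> - \<beta>) \<le> real x powr b" .
      have "2 powr real u \<le> 2 powr (real u * l)"
        using l by (intro powr_mono) (auto simp: mult_le_cancel_left1)
      then have "real x * real x powr \<alpha> * l powr (\<alpha> - \<beta>) * 2 ^ u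
          \<le> real x * real x powr \<alpha> * real x powr b * 2 powr (real u * l)"
        using 1 by (intro mult_mono) (auto simp: powr_realpow)
      also have "\<dots> = 2 powr ((1 + \<alpha> + b + real u) * l)"
        unfolding xl[symmetric] by (simp add: powr_powr powr_add[symmetric] algebra_simps)
      also have "\<dots> \<le> 2 ^ s"
        using s_ge by (simp add: powr_realpow[symmetric])
      finally have "real x * (real x powr \<alpha> * l powr (\<alpha> - \<beta>) * 2 ^ u) \<le> 2 ^ s"
        by (simp add: mult.assoc)
      then have "real x / 2 ^ s \<le> 1 / (real x powr \<alpha> * l powr (\<alpha> - \<beta>) * 2 ^ u)"
        using l x by (simp add: field_simps)
      also have "\<dots> = \<eta> * E"
        using powr_minus[of l "\<alpha> - \<beta>"] by (simp add: \<eta>_def E_def field_simps)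
      finally show ?thesis .
    qed
    define k where "k = x * (s + 3)"
    have xk: "x \<le> k" by (simp add: k_def)
    have k_le: "real k \<le> A * (real x * l)"
      using mult_left_mono[OF s_le, of "real x"] by (simp add: k_def algebra_simps)
    have log_k_ge: "l \<le> log 2 (real k)"
      using xk x by (simp add: l_def)
    have log_k_le: "log 2 (real k) \<le> 3 * A * l"
    proof -
      have "log 2 (real k) \<le> log 2 (A * (real x * l))"
        using k_le xk x by (intro log_mono) auto
      also have "\<dots> = log 2 A + (l + log 2 l)"
      proof -
        have "log 2 (A * (real x * l)) = log 2 A + log 2 (real x * l)"
          using A x l by (intro log_mult_pos) auto
        also have "log 2 (real x * l) = l + log 2 l"
          unfolding l_def[symmetric] using x l by (subst log_mult_pos) (auto simp: l_def[symmetric])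
        finally show ?thesis .
      qed
      also have "\<dots> \<le> A + (l + l)"
        using log2_le_self[of A] log2_le_self[of l] A l by simp
      also have "\<dots> \<le> A * l + (A * l + A * l)"
        using A l by (intro add_mono) (auto simp: mult_le_cancel_left1 mult_le_cancel_right1)
      finally show ?thesis by simp
    qed
    have num: "(3 * A) powr (- \<bar>\<beta>\<bar>) * l powr \<beta> \<le> log 2 (real k) powr \<beta>"
    proof (cases "\<beta> \<ge> 0")
      case True
      have "(3 * A) powr (- \<bar>\<beta>\<bar>) \<le> (3 * A) powr 0"
        using A by (intro powr_mono) auto
      then have "(3 * A) powr (- \<bar>\<beta>\<bar>) \<le> 1" using A by simp
      moreover have "l powr \<beta> \<le> log 2 (real k) powr \<beta>"
        using True l log_k_ge by (intro powr_mono2) auto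
      ultimately have "(3 * A) powr (- \<bar>\<beta>\<bar>) * l powr \<beta> \<le> 1 * log 2 (real k) powr \<beta>"
        by (intro mult_mono) auto
      then show ?thesis by simp
    next
      case False
      then have "(3 * A) powr (- \<bar>\<beta>\<bar>) * l powr \<beta> = (3 * A * l) powr \<beta>"
        using A l by (subst powr_mult) auto
      also have "\<dots> \<le> log 2 (real k) powr \<beta>"
        using False l log_k_ge log_k_le by (intro powr_mono2') auto
      finally show ?thesis .
    qed
    have den: "real k powr \<alpha> \<le> (3 * A) powr \<alpha> * (real x powr \<alpha> * l powr \<alpha>)"
    proof -
      have "real k \<le> 3 * A * (real x * l)"
        using k_le A l by (simp add: mult.assoc)
      then have "real k powr \<alpha> \<le> (3 * A * (real x * l)) powr \<alpha>"
        using \<alpha> by (intro powr_mono2) auto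
      then show ?thesis using A l by (simp add: powr_mult)
    qed
    have "2 * (\<eta> * E) < C * (3 * A) powr (- g) * E"
      using mult_strict_right_mono[OF \<eta> E] by (simp add: mult.assoc)
    also have "\<dots> = C * ((3 * A) powr (- \<bar>\<beta>\<bar>) * l powr \<beta> / ((3 * A) powr \<alpha> * (real x powr \<alpha> * l powr \<alpha>)))"
    proof -
      have "(3 * A) powr (- g) = (3 * A) powr (- \<bar>\<beta>\<bar>) / (3 * A) powr \<alpha>"
      proof -
        have "- g = - \<bar>\<beta>\<bar> - \<alpha>" by (simp add: g_def)
        then show ?thesis by (simp only: powr_diff)
      qed
      then show ?thesis by (simp add: E_def powr_diff ac_simps)
    qed
    also have "\<dots> \<le> C * (log 2 (real k) powr \<beta> / real k powr \<alpha>)"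
      using C num den xk x by (intro mult_left_mono frac_le) auto
    finally have "ereal (2 * (\<eta> * E)) < ereal (C * (log 2 (real k) powr \<beta> / real k powr \<alpha>))"
      by simp
    also have "\<dots> \<le> entropy_number k K"
      using xk x by (intro entropy) simp
    finally show ?thesis
      using level unfolding E_def l_def k_def by blast
  qed
  with \<open>\<eta> > 0\<close> show thesis by (rule that)
qed

lemma width_ge_log_power:
  fixes K :: "'a::real_inner set" and \<alpha> \<beta> C :: real
  assumes sup1: "(SUP f\<in>K. ereal (norm f)) = 1"
    and "\<alpha> \<ge> 0" "C > 0"
    and "\<And>n::nat. n \<ge> 2 \<Longrightarrow>
        ereal (C * (log 2 (real n) powr \<beta> / real n powr \<alpha>)) \<le> entropy_number n K"
  shows "\<exists>C''>0. \<forall>N::real>1. \<forall>n::nat\<ge>1.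
    ereal (C'' * (log 2 (real n + real_of_int \<lceil>log 2 N\<rceil>) powr (\<beta> - \<alpha>)
                   / (real n + real_of_int \<lceil>log 2 N\<rceil>) powr \<alpha>))
      \<le> nonlinear_kolmogorov_width (n - 1) K N"
proof -
  obtain \<eta> where \<eta>: "\<eta> > 0"
    and levels: "\<And>x::nat. x \<ge> 2 \<Longrightarrow>
      \<exists>s. real x / 2 ^ s \<le> \<eta> * (log 2 (real x) powr (\<beta> - \<alpha>) / real x powr \<alpha>) \<and>
        ereal (2 * (\<eta> * (log 2 (real x) powr (\<beta> - \<alpha>) / real x powr \<alpha>)))
          < entropy_number (x * (s + 3)) K"
    using log_power_levels[OF assms(2-4)] by blast
  define \<phi> where "\<phi> = (\<lambda>x::real. \<eta> * (log 2 x powr (\<beta> - \<alpha>) / x powr \<alpha>))"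
  have "\<exists>s. \<exists>\<epsilon>>0. \<phi> (real x) \<le> \<epsilon> \<and> real x / 2 ^ s \<le> \<epsilon> \<and>
      ereal (2 * \<epsilon>) < entropy_number (x * (s + 3)) K" if "x \<ge> 2" for x :: nat
  proof -
    have "log 2 (real x) > 0" using that by simp
    then have "log 2 (real x) powr (\<beta> - \<alpha>) > 0" by (metis less_irrefl powr_gt_zero)
    then have "\<phi> (real x) > 0"
      using that \<eta> unfolding \<phi>_def by (intro mult_pos_pos divide_pos_pos) auto
    moreover have "\<exists>s. real x / 2 ^ s \<le> \<phi> (real x) \<and>
        ereal (2 * \<phi> (real x)) < entropy_number (x * (s + 3)) K"
      using levels[OF that] unfolding \<phi>_def .
    ultimately show ?thesis by blast
  qed
  from width_lower_bound_uniform[OF sup1 this] \<eta> show ?thesis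
    unfolding \<phi>_def by blast
qed

section \<open>Entropy numbers of subexponential decay\<close>

text \<open>
  With \<open>t = s + 3\<close> and \<open>\<epsilon> = x / 2\<^sup>s\<close>, the requirement \<open>2 \<epsilon> < C 2 powr (- c (x t)\<^sup>\<alpha>)\<close> reads
  \<open>c (x t)\<^sup>\<alpha> + log 2 x + 4 - log 2 C < t\<close>.  Take \<open>t\<close> just above \<open>B y\<close>, where \<open>y = x\<^sup>\<gamma>\<close> and
  \<open>\<gamma> = \<alpha> / (1 - \<alpha>)\<close>.  Since \<open>x\<^sup>\<alpha> = y powr (1 - \<alpha>)\<close>, the first lower bound on \<open>B\<close> makes
  \<open>c (x t)\<^sup>\<alpha> \<le> t / 2\<close>; the second one makes the rest less than \<open>t / 2\<close>, using
  \<open>log 2 x = log 2 y / \<gamma> \<le> y / \<gamma>\<close>.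
\<close>

lemma width_ge_subexponential:
  fixes K :: "'a::real_inner set" and \<alpha> C c :: real
  assumes sup1: "(SUP f\<in>K. ereal (norm f)) = 1"
    and \<alpha>: "0 < \<alpha>" "\<alpha> < 1" and C: "C > 0" and c: "c > 0"
    and entropy: "\<And>n::nat. n \<ge> 1 \<Longrightarrow> ereal (C * 2 powr (- (c * real n powr \<alpha>))) \<le> entropy_number n K"
  shows "\<exists>C''>0. \<exists>c''>0. \<forall>N::real>1. \<forall>n::nat\<ge>1.
    ereal (C'' * 2 powr (- (c'' * (real n + real_of_int \<lceil>log 2 N\<rceil>) powr (\<alpha> / (1 - \<alpha>)))))
      \<le> nonlinear_kolmogorov_width (n - 1) K N"
proof -
  define \<gamma> where "\<gamma> = \<alpha> / (1 - \<alpha>)"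
  have \<gamma>: "\<gamma> > 0" using \<alpha> by (simp add: \<gamma>_def)
  define B where "B = max ((2 * c) powr (1 / (1 - \<alpha>))) (2 * (5 + 1 / \<gamma> + \<bar>log 2 C\<bar>))"
  have B1: "2 * c \<le> B powr (1 - \<alpha>)"
  proof -
    have "2 * c = ((2 * c) powr (1 / (1 - \<alpha>))) powr (1 - \<alpha>)"
      using c \<alpha> by (simp add: powr_powr)
    also have "\<dots> \<le> B powr (1 - \<alpha>)"
      using \<alpha> by (intro powr_mono2) (auto simp: B_def)
    finally show ?thesis .
  qed
  have B2: "2 * (5 + 1 / \<gamma> + \<bar>log 2 C\<bar>) \<le> B" by (simp add: B_def)
  have "B > 0" using B2 \<gamma> by (smt (verit) divide_pos_pos)
  define \<phi> where "\<phi> = (\<lambda>x::real. 2 powr (- ((B + 1) * x powr \<gamma>)))"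
  have "\<exists>s. \<exists>\<epsilon>>0. \<phi> (real x) \<le> \<epsilon> \<and> real x / 2 ^ s \<le> \<epsilon> \<and>
      ereal (2 * \<epsilon>) < entropy_number (x * (s + 3)) K" if x: "x \<ge> 2" for x :: nat
  proof -
    define y where "y = real x powr \<gamma>"
    have y: "y \<ge> 1" using x \<gamma> by (simp add: y_def ge_one_powr_ge_zero)
    define t where "t = nat \<lceil>B * y\<rceil>"
    have "B \<le> B * y" using y \<open>B > 0\<close> by (simp add: mult_le_cancel_left1)
    moreover have "10 \<le> B" using B2 \<gamma> by (smt (verit) divide_pos_pos)
    ultimately have "10 \<le> B * y" by (rule order_trans[rotated])
    then have t: "B * y \<le> real t" "real t \<le> B * y + 1" "real t \<ge> 10"
      unfolding t_def by linarith+
    define s where "s = t - 3"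
    have st: "s + 3 = t" "real s = real t - 3" using t(3) by (auto simp: s_def)
    have "c * real (x * t) powr \<alpha> \<le> real t / 2"
    proof -
      have xy: "real x powr \<alpha> = y powr (1 - \<alpha>)"
        using \<alpha> by (simp add: y_def powr_powr \<gamma>_def)
      have "2 * c * real x powr \<alpha> \<le> B powr (1 - \<alpha>) * y powr (1 - \<alpha>)"
        unfolding xy using B1 by (intro mult_right_mono) auto
      also have "B powr (1 - \<alpha>) * y powr (1 - \<alpha>) = (B * y) powr (1 - \<alpha>)"
        using \<open>B > 0\<close> y by (simp add: powr_mult)
      also have "\<dots> \<le> real t powr (1 - \<alpha>)"
        using \<alpha> t(1) \<open>B > 0\<close> y by (intro powr_mono2) auto
      finally have "2 * c * real x powr \<alpha> * real t powr \<alpha> \<le> real t powr (1 - \<alpha>) * real t powr \<alpha>"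
        by (rule mult_right_mono) simp
      also have "\<dots> = real t"
        using t(3) by (simp add: powr_add[symmetric])
      finally show ?thesis by (simp add: powr_mult)
    qed
    moreover have "log 2 (real x) + 4 - log 2 C < real t / 2"
    proof -
      have "log 2 (real x) * \<gamma> = log 2 y"
        using x by (simp add: y_def log_powr)
      also have "\<dots> \<le> y" using y by (intro log2_le_self) simp
      finally have "log 2 (real x) \<le> 1 / \<gamma> * y" using \<gamma> by (simp add: field_simps)
      moreover have "4 - log 2 C < (5 + \<bar>log 2 C\<bar>) * 1" by simp
      moreover have "(5 + \<bar>log 2 C\<bar>) * 1 \<le> (5 + \<bar>log 2 C\<bar>) * y"
        using y by (intro mult_left_mono) auto
      ultimately have "log 2 (real x) + 4 - log 2 C < (5 + 1 / \<gamma> + \<bar>log 2 C\<bar>) * y"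
        by (simp add: algebra_simps)
      also have "\<dots> \<le> (B / 2) * y"
        using B2 y by (intro mult_right_mono) auto
      finally show ?thesis using t(1) by simp
    qed
    ultimately have "1 + log 2 (real x) - real s < log 2 C - c * real (x * t) powr \<alpha>"
      unfolding st(2) by linarith
    then have "2 powr (1 + log 2 (real x) - real s) < 2 powr (log 2 C - c * real (x * t) powr \<alpha>)"
      by simp
    moreover have "2 powr (1 + log 2 (real x) - real s) = 2 * (real x / 2 ^ s)"
      using x by (simp add: powr_add powr_diff powr_realpow)
    moreover have "2 powr (log 2 C - c * real (x * t) powr \<alpha>) = C * 2 powr (- (c * real (x * t) powr \<alpha>))"
      using C by (simp add: powr_diff powr_minus divide_inverse)
    ultimately have "ereal (2 * (real x / 2 ^ s)) < ereal (C * 2 powr (- (c * real (x * t) powr \<alpha>)))"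
      by simp
    also have "\<dots> \<le> entropy_number (x * t) K"
      using x t(3) by (intro entropy) auto
    finally have "ereal (2 * (real x / 2 ^ s)) < entropy_number (x * (s + 3)) K"
      using st(1) by simp
    moreover have "\<phi> (real x) \<le> real x / 2 ^ s"
    proof -
      have "\<phi> (real x) \<le> 2 powr (- real s)"
        using t(2) st(2) y by (auto simp: \<phi>_def y_def algebra_simps)
      also have "\<dots> = 1 / 2 ^ s" by (simp add: powr_minus powr_realpow divide_inverse)
      also have "\<dots> \<le> real x / 2 ^ s" using x by (intro divide_right_mono) auto
      finally show ?thesis .
    qed
    moreover have "real x / 2 ^ s > 0" using x by simp
    ultimately show ?thesis by blast
  qed
  from width_lower_bound_uniform[OF sup1 this] \<open>B > 0\<close> show ?thesis
    unfolding \<phi>_def \<gamma>_def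
    by (intro exI[of _ 1] conjI exI[of _ "B + 1"]) auto
qed

theorem theorem4p3:
  fixes K :: "'a::{real_inner, complete_space} set"
  assumes "compact K"
    and "(SUP f\<in>K. ereal (norm f)) = 1"
  shows
    "(\<forall>\<alpha> \<beta> C :: real. \<alpha> > 0 \<longrightarrow> C > 0 \<longrightarrow>
        (\<forall>n::nat\<ge>2. entropy_number n K \<ge>
            ereal (C * (log 2 (real n) powr \<beta> / real n powr \<alpha>))) \<longrightarrow>
        (\<exists>C''>0. \<forall>N::real>1. \<forall>n::nat\<ge>1.
            nonlinear_kolmogorov_width (n - 1) K N \<ge>
              ereal (C'' * (log 2 (real n + real_of_int \<lceil>log 2 N\<rceil>) powr (\<beta> - \<alpha>)
                             / (real n + real_of_int \<lceil>log 2 N\<rceil>) powr \<alpha>))))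
   \<and> (\<forall>\<alpha> C :: real. \<alpha> > 0 \<longrightarrow> C > 0 \<longrightarrow>
        (\<forall>n::nat\<ge>2. entropy_number n K \<ge> ereal (C / log 2 (real n) powr \<alpha>)) \<longrightarrow>
        (\<exists>C''>0. \<forall>N::real>1. \<forall>n::nat\<ge>1.
            nonlinear_kolmogorov_width (n - 1) K N \<ge>
              ereal (C'' * (1 / log 2 (real n + real_of_int \<lceil>log 2 N\<rceil>) powr \<alpha>))))
   \<and> (\<forall>\<alpha> C c :: real. 0 < \<alpha> \<longrightarrow> \<alpha> < 1 \<longrightarrow> C > 0 \<longrightarrow> c > 0 \<longrightarrow>
        (\<forall>n::nat\<ge>1. entropy_number n K \<ge> ereal (C * 2 powr (- (c * real n powr \<alpha>)))) \<longrightarrow>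
        (\<exists>C''>0. \<exists>c''>0. \<forall>N::real>1. \<forall>n::nat\<ge>1.
            nonlinear_kolmogorov_width (n - 1) K N \<ge>
              ereal (C'' * 2 powr (- (c'' * (real n + real_of_int \<lceil>log 2 N\<rceil>)
                                              powr (\<alpha> / (1 - \<alpha>)))))))"
proof (intro conjI allI impI)
  fix \<alpha> \<beta> C :: real
  assume "\<alpha> > 0" "C > 0" and
    "\<forall>n::nat\<ge>2. entropy_number n K \<ge> ereal (C * (log 2 (real n) powr \<beta> / real n powr \<alpha>))"
  then show "\<exists>C''>0. \<forall>N::real>1. \<forall>n::nat\<ge>1.
      nonlinear_kolmogorov_width (n - 1) K N \<ge>
        ereal (C'' * (log 2 (real n + real_of_int \<lceil>log 2 N\<rceil>) powr (\<beta> - \<alpha>)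
                       / (real n + real_of_int \<lceil>log 2 N\<rceil>) powr \<alpha>))"
    using width_ge_log_power[OF assms(2), where \<alpha> = \<alpha> and \<beta> = \<beta> and C = C] by auto
next
  fix \<alpha> C :: real
  assume "\<alpha> > 0" and C: "C > 0" and
    entropy: "\<forall>n::nat\<ge>2. entropy_number n K \<ge> ereal (C / log 2 (real n) powr \<alpha>)"
  \<comment> \<open>The logarithmic case is the previous one with \<open>0\<close> in place of \<open>\<alpha>\<close> and \<open>- \<alpha>\<close> in place of \<open>\<beta>\<close>.\<close>
  have "\<exists>C''>0. \<forall>N::real>1. \<forall>n::nat\<ge>1.
      nonlinear_kolmogorov_width (n - 1) K N \<ge>
        ereal (C'' * (log 2 (real n + real_of_int \<lceil>log 2 N\<rceil>) powr (- \<alpha> - 0)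
                       / (real n + real_of_int \<lceil>log 2 N\<rceil>) powr 0))"
  proof (rule width_ge_log_power[OF assms(2) _ C])
    fix n :: nat assume "n \<ge> 2"
    then show "entropy_number n K \<ge> ereal (C * (log 2 (real n) powr (- \<alpha>) / real n powr 0))"
      using entropy by (simp add: powr_minus divide_inverse)
  qed simp
  then obtain C'' where C'': "C'' > 0" and
    width: "\<And>N n. N > 1 \<Longrightarrow> n \<ge> 1 \<Longrightarrow> nonlinear_kolmogorov_width (n - 1) K N \<ge>
        ereal (C'' * (log 2 (real n + real_of_int \<lceil>log 2 N\<rceil>) powr (- \<alpha> - 0)
                       / (real n + real_of_int \<lceil>log 2 N\<rceil>) powr 0))"
    by blast
  have "nonlinear_kolmogorov_width (n - 1) K N \<ge>
      ereal (C'' * (1 / log 2 (real n + real_of_int \<lceil>log 2 N\<rceil>) powr \<alpha>))"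
    if "N > 1" "n \<ge> 1" for N :: real and n :: nat
  proof -
    have "0 < log 2 N" using that(1) by simp
    then have "real n + real_of_int \<lceil>log 2 N\<rceil> > 0" using that(2) by linarith
    then show ?thesis using width[OF that] by (simp add: powr_minus divide_inverse)
  qed
  with C'' show "\<exists>C''>0. \<forall>N::real>1. \<forall>n::nat\<ge>1.
      nonlinear_kolmogorov_width (n - 1) K N \<ge>
        ereal (C'' * (1 / log 2 (real n + real_of_int \<lceil>log 2 N\<rceil>) powr \<alpha>))"
    by blast
next
  fix \<alpha> C c :: real
  assume "0 < \<alpha>" "\<alpha> < 1" "C > 0" "c > 0" and
    "\<forall>n::nat\<ge>1. entropy_number n K \<ge> ereal (C * 2 powr (- (c * real n powr \<alpha>)))"
  then show "\<exists>C''>0. \<exists>c''>0. \<forall>N::real>1. \<forall>n::nat\<ge>1.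
      nonlinear_kolmogorov_width (n - 1) K N \<ge>
        ereal (C'' * 2 powr (- (c'' * (real n + real_of_int \<lceil>log 2 N\<rceil>)
                                        powr (\<alpha> / (1 - \<alpha>)))))"
    using width_ge_subexponential[OF assms(2), where \<alpha> = \<alpha> and C = C and c = c] by auto
qed

end
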